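(* Let $A=(a,b,c,d,u_0,w_0)$ be real parameters with $ad-bc=1$ and $b\neq 0$. Let $\phi\in L^2(\mathbb{R})\setminus\{0\}$ be a window function, $f\in L^2(\mathbb{R})$ and $t_0\in\mathbb{R}$, and put $T_{t_0}f(t)=f(t-t_0)$. Then for all $u,w\in\mathbb{R}$, $$V^{A}_{\phi}\{T_{t_0}f\}(u,w)=V^{A}_{\phi}\{f\}(u-at_0,\,w-t_0)\; e^{iat_0w_0-i\frac{ac}{2}t_0^2+ict_0(u-u_0)}.$$
   Context: All functions are complex-valued. For $A=(a,b,c,d,u_0,w_0)\in\mathbb{R}^6$ with $ad-bc=1$, $b\neq 0$, the offset linear canonical transform kernel is $$K_A(t,u)=\frac{1}{\sqrt{i2\pi b}}\exp\Big(i\frac{a}{2b}t^2-i\frac1b t(u-u_0)-i\frac1b u(du_0-bw_0)+i\frac{d}{2b}(u^2+u_0^2)\Big)$$ (principal square root). For $\phi\in L^2(\mathbb{R})\setminus\{0\}$ and $f\in L^2(\mathbb{R})$, the windowed offset linear canonical transform (WOLCT) is $$V^A_\phi \{f\}(u,w)=V^A_\phi f(u,w)=\int_{\mathbb{R}} f(t)\,\overline{\phi(t-w)}\,K_A(t,u)\,dt .$$ *)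

theory Defs
  imports "HOL-Analysis.Analysis"
begin

text \<open>
  Elements of \<open>L\<^sup>2(\<real>)\<close> are represented by Lebesgue measurable, square-integrable
  functions; nothing is identified modulo null sets, so being nonzero in \<open>L\<^sup>2\<close>
  has to be stated as not being zero almost everywhere.
\<close>

definition L2 :: "(real \<Rightarrow> complex) set" where
  "L2 = {f \<in> borel_measurable lebesgue. integrable lebesgue (\<lambda>t. (cmod (f t))\<^sup>2)}"

definition L2_nonzero :: "(real \<Rightarrow> complex) set" where
  "L2_nonzero = {f \<in> L2. \<not> (AE t in lebesgue. f t = 0)}"

text \<open>Parameter tuples are \<open>(a, b, c, d, u\<^sub>0, w\<^sub>0)\<close>.\<close>

type_synonym olct_params = "real \<times> real \<times> real \<times> real \<times> real \<times> real"

fun olct_kernel :: "olct_params \<Rightarrow> real \<Rightarrow> real \<Rightarrow> complex" where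
  "olct_kernel (a, b, c, d, u0, w0) t u =
     1 / csqrt (\<i> * 2 * complex_of_real pi * complex_of_real b) *
     exp (\<i> * complex_of_real (a / (2 * b) * t\<^sup>2)
          - \<i> * complex_of_real (1 / b * t * (u - u0))
          - \<i> * complex_of_real (1 / b * u * (d * u0 - b * w0))
          + \<i> * complex_of_real (d / (2 * b) * (u\<^sup>2 + u0\<^sup>2)))"

definition wolct ::
  "olct_params \<Rightarrow> (real \<Rightarrow> complex) \<Rightarrow> (real \<Rightarrow> complex) \<Rightarrow> real \<Rightarrow> real \<Rightarrow> complex" where
  "wolct A \<phi> f u w = (LINT t|lebesgue. f t * cnj (\<phi> (t - w)) * olct_kernel A t u)"

definition translate :: "real \<Rightarrow> (real \<Rightarrow> complex) \<Rightarrow> real \<Rightarrow> complex" where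
  "translate t0 f = (\<lambda>t. f (t - t0))"

end

theory Submission
  imports Defs
begin

text \<open>Substituting \<open>t0 + t\<close> for \<open>t\<close> in the integral moves the shift
  from \<open>f\<close> onto the window, whose offset becomes \<open>w - t0\<close>, and onto the
  kernel. The kernel is a chirp: expanding \<open>(t0 + t)\<^sup>2\<close> gives the cross term
  \<open>a * t0 * t / b\<close>, which is linear in \<open>t\<close> and so amounts to replacing
  \<open>u\<close> by \<open>u - a * t0\<close>. What remains of the phase is free of
  \<open>t\<close> and leaves the integral as the stated exponential.
  \<open>lebesgue_integral_translation\<close> justifies the substitution,
  \<open>olct_kernel_translate\<close> computes the phase.\<close>

lemma translation_measurable_lebesgue: "(\<lambda>x. s + x) \<in> lebesgue \<rightarrow>\<^sub>M lebesgue" for s :: real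
  using lebesgue_affine_measurable[of "\<lambda>_. 1" s] by simp

lemma distr_lebesgue_translation: "distr lebesgue lebesgue (\<lambda>x. s + x) = lebesgue" for s :: real
  using lebesgue_real_affine[of 1 s] by (simp add: density_1 flip: one_ennreal_def)

lemma lebesgue_integral_translation:
  fixes f :: "real \<Rightarrow> 'a :: {banach, second_countable_topology}"
  shows "(LINT x|lebesgue. f (s + x)) = (LINT x|lebesgue. f x)"
proof (cases "f \<in> borel_measurable lebesgue")
  case True
  then show ?thesis
    using integral_distr[OF translation_measurable_lebesgue, of f s]
    by (simp add: distr_lebesgue_translation)
next
  \<comment> \<open>Translating back by \<open>- s\<close> shows that the shifted function is not
    measurable either, so both integrals have the default value 0.\<close>
  case False
  have "(\<lambda>x. f (s + x)) \<notin> borel_measurable lebesgue"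
  proof
    assume "(\<lambda>x. f (s + x)) \<in> borel_measurable lebesgue"
    from measurable_compose[OF translation_measurable_lebesgue[of "- s"] this]
    show False using False by simp
  qed
  with False show ?thesis
    by (metis borel_measurable_integrable not_integrable_integral_eq)
qed

text \<open>The square-root prefactor depends on \<open>b\<close> alone, so only phases are
  compared. After the cross term is absorbed into \<open>u\<close>, the determinant condition in the
  form \<open>(a * d - 1) / b = c\<close> turns the remaining coefficients of
  \<open>t0 * (u - u0)\<close> and \<open>t0\<^sup>2\<close> into \<open>c\<close> and
  \<open>- a * c / 2\<close>; the term \<open>a * t0 * w0\<close> comes from the factor
  \<open>d * u0 - b * w0\<close>.\<close>

lemma olct_kernel_translate:
  assumes "a * d - b * c = 1" and "b \<noteq> 0"
  shows "olct_kernel (a, b, c, d, u0, w0) (t0 + t) u =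
    olct_kernel (a, b, c, d, u0, w0) t (u - a * t0) *
    exp (\<i> * complex_of_real (a * t0 * w0)
         - \<i> * complex_of_real (a * c / 2 * t0\<^sup>2)
         + \<i> * complex_of_real (c * t0 * (u - u0)))"
proof -
  \<comment> \<open>Eliminating \<open>c\<close> makes the phase equation a rational identity in
    free variables, with powers of \<open>b\<close> as its only denominators.\<close>
  have c: "c = (a * d - 1) / b"
    using assms by (simp add: field_simps)
  have phase:
    "a / (2 * b) * (t0 + t)\<^sup>2 - 1 / b * (t0 + t) * (u - u0)
       - 1 / b * u * (d * u0 - b * w0) + d / (2 * b) * (u\<^sup>2 + u0\<^sup>2) =
     (a / (2 * b) * t\<^sup>2 - 1 / b * t * (u - a * t0 - u0)
       - 1 / b * (u - a * t0) * (d * u0 - b * w0) + d / (2 * b) * ((u - a * t0)\<^sup>2 + u0\<^sup>2))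
     + (a * t0 * w0 - a * c / 2 * t0\<^sup>2 + c * t0 * (u - u0))"
    unfolding c using \<open>b \<noteq> 0\<close> by (simp add: field_simps power2_eq_square)
  have combine: "\<i> * complex_of_real p - \<i> * complex_of_real q - \<i> * complex_of_real r
      + \<i> * complex_of_real s = \<i> * complex_of_real (p - q - r + s)"
    "\<i> * complex_of_real p - \<i> * complex_of_real q + \<i> * complex_of_real r
      = \<i> * complex_of_real (p - q + r)" for p q r s
    by (simp_all add: algebra_simps)
  have exp_split: "exp (\<i> * complex_of_real (p + q)) =
      exp (\<i> * complex_of_real p) * exp (\<i> * complex_of_real q)" for p q
    by (simp add: distrib_left exp_add)
  show ?thesis
    unfolding olct_kernel.simps combine phase
    by (subst exp_split) (rule mult.assoc[symmetric])
qed

theorem mainTheorem2: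
  fixes a b c d u0 w0 t0 :: real
    and A :: olct_params
    and \<phi> f :: "real \<Rightarrow> complex"
  assumes "A = (a, b, c, d, u0, w0)"
    and "a * d - b * c = 1"
    and "b \<noteq> 0"
    and "\<phi> \<in> L2_nonzero"
    and "f \<in> L2"
  shows "\<forall>u w :: real.
    wolct A \<phi> (translate t0 f) u w =
    wolct A \<phi> f (u - a * t0) (w - t0) *
    exp (\<i> * complex_of_real (a * t0 * w0)
         - \<i> * complex_of_real (a * c / 2 * t0\<^sup>2)
         + \<i> * complex_of_real (c * t0 * (u - u0)))"
proof (intro allI)
  fix u w :: real
  let ?E = "exp (\<i> * complex_of_real (a * t0 * w0)
         - \<i> * complex_of_real (a * c / 2 * t0\<^sup>2)
         + \<i> * complex_of_real (c * t0 * (u - u0)))"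
  have "wolct A \<phi> (translate t0 f) u w =
      (LINT t|lebesgue. f (t0 + t - t0) * cnj (\<phi> (t0 + t - w)) * olct_kernel A (t0 + t) u)"
    unfolding wolct_def translate_def
    by (rule lebesgue_integral_translation[symmetric])
  \<comment> \<open>The window argument regroups as \<open>t0 + t - w = t - (w - t0)\<close>; the
    phase factor does not contain \<open>t\<close>, so it can be pulled out next.\<close>
  also have "\<dots> = (LINT t|lebesgue.
      f t * cnj (\<phi> (t - (w - t0))) * olct_kernel A t (u - a * t0) * ?E)"
    unfolding assms(1) olct_kernel_translate[OF assms(2,3)]
    by (simp add: algebra_simps del: olct_kernel.simps)
  also have "\<dots> = wolct A \<phi> f (u - a * t0) (w - t0) * ?E"
    unfolding wolct_def by (rule integral_mult_left_zero)
  finally show "wolct A \<phi> (translate t0 f) u w =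
      wolct A \<phi> f (u - a * t0) (w - t0) * ?E" .
qed

end
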